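(* Let $G$ be a bipartite graph of order $n$ with least adjacency eigenvalue $\lambda_n(G)$, and let $\lambda_1(\overline{G})$ be the largest adjacency eigenvalue of its complement. Then $\lambda_1(\overline{G})=-1-\lambda_n(G)$ if and only if $G$ is a balanced complete bipartite graph, i.e. $G\cong K_{r,r}$ for some positive integer $r$.
   Context: Eigenvalues of a graph are those of its adjacency matrix, listed as $\lambda_1\ge\cdots\ge\lambda_n$. *)

theory Defs
  imports
    "Graph_Theory.Pair_Digraph"
    "Graph_Theory.Kuratowski"
    "Jordan_Normal_Form.Spectral_Radius"
begin

text \<open>A finite simple graph is a \<open>pair_graph\<close>: a finite vertex set together with a symmetric,
  irreflexive set of arcs, each undirected edge \<open>uv\<close> being the two arcs \<open>(u, v)\<close> and \<open>(v, u)\<close>.\<close>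

definition bipartite :: "'a pair_pre_digraph \<Rightarrow> bool" where
  "bipartite G \<longleftrightarrow> (\<exists>U W. pverts G = U \<union> W \<and> U \<inter> W = {} \<and> parcs G \<subseteq> U \<times> W \<union> W \<times> U)"

definition complement :: "'a pair_pre_digraph \<Rightarrow> 'a pair_pre_digraph" where
  "complement G = \<lparr> pverts = pverts G,
     parcs = {(u, v). u \<in> pverts G \<and> v \<in> pverts G \<and> u \<noteq> v \<and> (u, v) \<notin> parcs G} \<rparr>"

text \<open>Rows and columns follow the order in which the list \<open>vs\<close> enumerates the vertices.\<close>

definition adjacency_matrix :: "'a list \<Rightarrow> 'a pair_pre_digraph \<Rightarrow> real mat" where
  "adjacency_matrix vs G = mat (length vs) (length vs)
     (\<lambda>(i, j). if (vs ! i, vs ! j) \<in> parcs G then 1 else 0)"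

text \<open>The choice of enumeration is immaterial, see \<open>adj_spectrum_eq\<close> below. As the adjacency
  matrix is symmetric, its real eigenvalues are all of its eigenvalues.\<close>

definition adj_spectrum :: "'a pair_pre_digraph \<Rightarrow> real set" where
  "adj_spectrum G = spectrum (adjacency_matrix (SOME vs. distinct vs \<and> set vs = pverts G) G)"

definition largest_eigenvalue :: "'a pair_pre_digraph \<Rightarrow> real" where
  "largest_eigenvalue G = Max (adj_spectrum G)"

definition least_eigenvalue :: "'a pair_pre_digraph \<Rightarrow> real" where
  "least_eigenvalue G = Min (adj_spectrum G)"

lemma pair_graph_complement:
  assumes "pair_graph G"
  shows "pair_graph (complement G)"
proof -
  interpret pair_graph G by (rule assms)
  have "finite (parcs (complement G))"
    by (rule finite_subset[of _ "pverts G \<times> pverts G"])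
      (auto simp: complement_def pair_finite_verts)
  moreover have "(v, u) \<in> parcs G" if "(u, v) \<in> parcs G" for u v
    using pair_sym_arcs that by (auto simp: symmetric_def dest: symD)
  ultimately show ?thesis
    by unfold_locales
      (auto simp: complement_def pair_finite_verts symmetric_def intro!: symI)
qed

lemma eigenvalue_adjacency_matrix_iff:
  assumes "distinct vs" and "set vs = pverts G"
  shows "eigenvalue (adjacency_matrix vs G) k \<longleftrightarrow>
    (\<exists>x. (\<exists>u\<in>pverts G. x u \<noteq> 0) \<and>
      (\<forall>u\<in>pverts G. (\<Sum>v\<in>pverts G. if (u, v) \<in> parcs G then x v else 0) = k * x u))"
    (is "?L \<longleftrightarrow> ?R")
proof -
  let ?n = "length vs" and ?A = "adjacency_matrix vs G"
  have bij: "bij_betw ((!) vs) {0..<?n} (pverts G)"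
    using assms by (intro bij_betw_nth) auto
  have dims: "dim_row ?A = ?n" "dim_col ?A = ?n"
    by (auto simp: adjacency_matrix_def)
  have nth: "(?A *\<^sub>v vec ?n (\<lambda>i. x (vs ! i))) $ i =
      (\<Sum>v\<in>pverts G. if (vs ! i, v) \<in> parcs G then x v else 0)" if "i < ?n" for i x
  proof -
    have "(?A *\<^sub>v vec ?n (\<lambda>i. x (vs ! i))) $ i =
        (\<Sum>j\<in>{0..<?n}. if (vs ! i, vs ! j) \<in> parcs G then x (vs ! j) else 0)"
      using that by (auto simp: adjacency_matrix_def scalar_prod_def intro!: sum.cong)
    also have "\<dots> = (\<Sum>v\<in>pverts G. if (vs ! i, v) \<in> parcs G then x v else 0)"
      by (rule sum.reindex_bij_betw[OF bij])
    finally show ?thesis .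
  qed
  have all: "(\<forall>u\<in>pverts G. P u) \<longleftrightarrow> (\<forall>i<?n. P (vs ! i))" for P
    using assms(2) by (metis in_set_conv_nth)
  have ev: "eigenvector ?A (vec ?n (\<lambda>i. x (vs ! i))) k \<longleftrightarrow>
      (\<exists>u\<in>pverts G. x u \<noteq> 0) \<and>
      (\<forall>u\<in>pverts G. (\<Sum>v\<in>pverts G. if (u, v) \<in> parcs G then x v else 0) = k * x u)" for x
  proof -
    have "vec ?n (\<lambda>i. x (vs ! i)) \<noteq> 0\<^sub>v ?n \<longleftrightarrow> \<not> (\<forall>u\<in>pverts G. x u = 0)"
      unfolding all by (auto simp: vec_eq_iff)
    moreover have "?A *\<^sub>v vec ?n (\<lambda>i. x (vs ! i)) = k \<cdot>\<^sub>v vec ?n (\<lambda>i. x (vs ! i)) \<longleftrightarrow>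
        (\<forall>u\<in>pverts G. (\<Sum>v\<in>pverts G. if (u, v) \<in> parcs G then x v else 0) = k * x u)"
      unfolding all by (simp add: vec_eq_iff dims nth del: index_mult_mat_vec)
    ultimately show ?thesis
      unfolding eigenvector_def dims by auto
  qed
  show ?thesis
  proof
    assume ?L
    then obtain w where w: "eigenvector ?A w k"
      by (auto simp: eigenvalue_def)
    define x where "x v = w $ (the_inv_into {0..<?n} ((!) vs) v)" for v
    have "x (vs ! i) = w $ i" if "i < ?n" for i
      using that bij by (auto simp: x_def bij_betw_def the_inv_into_f_f)
    moreover have "dim_vec w = ?n"
      using w by (auto simp: eigenvector_def dims)
    ultimately have "w = vec ?n (\<lambda>i. x (vs ! i))"
      by auto
    then have "eigenvector ?A (vec ?n (\<lambda>i. x (vs ! i))) k"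
      using w by simp
    then show ?R unfolding ev by (rule exI[of _ x])
  next
    assume ?R
    then obtain x where "eigenvector ?A (vec ?n (\<lambda>i. x (vs ! i))) k"
      unfolding ev[symmetric] by (rule exE)
    then show ?L unfolding eigenvalue_def by (rule exI)
  qed
qed

lemma adj_spectrum_eq:
  assumes "distinct vs" and "set vs = pverts G"
  shows "adj_spectrum G = spectrum (adjacency_matrix vs G)"
proof -
  let ?us = "SOME vs. distinct vs \<and> set vs = pverts G"
  have us: "distinct ?us \<and> set ?us = pverts G"
    by (rule someI[of _ vs]) (use assms in auto)
  have "eigenvalue (adjacency_matrix ?us G) k = eigenvalue (adjacency_matrix vs G) k" for k
    unfolding eigenvalue_adjacency_matrix_iff[OF assms]
      eigenvalue_adjacency_matrix_iff[OF us[THEN conjunct1] us[THEN conjunct2]] ..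
  then show ?thesis
    by (auto simp only: adj_spectrum_def spectrum_def)
qed

end

theory Submission
  imports Defs "HOL-Analysis.Function_Topology"
begin

text \<open>Let \<open>U\<close> and \<open>W\<close> be the parts of \<open>G\<close>. Both are cliques of the complement, so the Rayleigh
  quotient of an indicator vector gives \<open>\<lambda>\<^sub>1 \<ge> max (card U) (card W) - 1\<close> there. If the identity
  holds, the least eigenvalue of \<open>G\<close> therefore has absolute value at least the size of both parts.
  At a vertex where an eigenvector has an entry of maximal modulus, the degree is at least the
  modulus of the eigenvalue; so this vertex is joined to the entire opposite part, all entries there
  have maximal modulus too, and the same argument applied to them yields \<open>K\<^sub>r\<^sub>,\<^sub>r\<close>.\<close>

section \<open>Maximising a quadratic form on the unit sphere\<close>

lemma compact_unit_sphere_fun: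
  assumes "finite V"
  shows "compact {x :: 'a \<Rightarrow> real. (\<forall>v. v \<notin> V \<longrightarrow> x v = 0) \<and> (\<Sum>v\<in>V. (x v)\<^sup>2) = 1}"
proof -
  \<comment> \<open>Vectors are functions on the whole type, so the coordinates outside
    \<open>V\<close> are pinned to 0. Every factor of the product is then compact, Tychonoff's
    theorem makes \<open>B\<close> compact, and the sphere is a closed subset of it.\<close>
  define B where "B = PiE UNIV (\<lambda>v. if v \<in> V then {-1..1} else {0::real})"
  have "compactin (product_topology (\<lambda>_. euclidean) UNIV) B"
    unfolding B_def compactin_PiE by auto
  then have "compact B"
    by (simp add: euclidean_product_topology)
  moreover have "closed {x :: 'a \<Rightarrow> real. (\<Sum>v\<in>V. (x v)\<^sup>2) = 1}"
    by (intro closed_Collect_eq continuous_intros) auto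
  ultimately have "compact (B \<inter> {x. (\<Sum>v\<in>V. (x v)\<^sup>2) = 1})"
    by (rule compact_Int_closed)
  moreover have "{x. (\<forall>v. v \<notin> V \<longrightarrow> x v = 0) \<and> (\<Sum>v\<in>V. (x v)\<^sup>2) = 1}
      = B \<inter> {x. (\<Sum>v\<in>V. (x v)\<^sup>2) = 1}" (is "?L = ?R")
  proof
    show "?R \<subseteq> ?L" by (auto simp: B_def PiE_iff split: if_splits)
    show "?L \<subseteq> ?R"
    proof
      fix x assume x: "x \<in> ?L"
      have "\<bar>x v\<bar> \<le> 1" if "v \<in> V" for v
      proof -
        have "(x v)\<^sup>2 \<le> (\<Sum>v\<in>V. (x v)\<^sup>2)"
          using assms that by (intro member_le_sum) auto
        then show ?thesis using x by (simp add: abs_square_le_1)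
      qed
      then show "x \<in> ?R" using x by (auto simp: B_def abs_le_iff minus_le_iff)
    qed
  qed
  ultimately show ?thesis by simp
qed

lemma linear_coeff_zero_if_quadratic_nonneg:
  fixes b c :: real
  assumes "\<And>t. 0 \<le> 2 * t * b + t\<^sup>2 * c"
  shows "b = 0"
proof (rule ccontr)
  assume "b \<noteq> 0"
  \<comment> \<open>For positive \<open>c\<close> the quadratic is minimal at
    \<open>- b / c\<close>. Replacing \<open>c\<close> by the positive bound \<open>d > c\<close>
    gives a witness that works for every sign of \<open>c\<close>.\<close>
  define d where "d = \<bar>c\<bar> + 1"
  have "d > 0" "c < d" by (auto simp: d_def)
  have "0 \<le> 2 * (- b / d) * b + (- b / d)\<^sup>2 * c" by (rule assms)
  also have "\<dots> = (b / d)\<^sup>2 * (c - 2 * d)"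
    using \<open>d > 0\<close> by (simp add: power2_eq_square field_simps)
  also have "\<dots> < 0"
    using \<open>b \<noteq> 0\<close> \<open>d > 0\<close> \<open>c < d\<close> by (intro mult_pos_neg) auto
  finally show False by simp
qed

text \<open>By compactness the form attains a maximum \<open>k\<close> on the unit sphere, and
  homogeneity extends the bound to all \<open>y\<close>. At a maximiser the first variation in each
  coordinate direction vanishes, which is the eigenvector equation. This supplies the part of the
  spectral theorem used below.\<close>

lemma rayleigh_max_eigenvector:
  fixes a :: "'a \<Rightarrow> 'a \<Rightarrow> real"
  assumes fin: "finite V" and ne: "V \<noteq> {}"
    and sym: "\<And>u v. u \<in> V \<Longrightarrow> v \<in> V \<Longrightarrow> a u v = a v u"
  obtains k x where "\<exists>u\<in>V. x u \<noteq> 0" "\<forall>u\<in>V. (\<Sum>v\<in>V. a u v * x v) = k * x u"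
    "\<And>y. (\<Sum>u\<in>V. \<Sum>v\<in>V. a u v * (y u * y v)) \<le> k * (\<Sum>v\<in>V. (y v)\<^sup>2)"
proof -
  define S where "S = {x :: 'a \<Rightarrow> real. (\<forall>v. v \<notin> V \<longrightarrow> x v = 0) \<and> (\<Sum>v\<in>V. (x v)\<^sup>2) = 1}"
  define Q where "Q y = (\<Sum>u\<in>V. \<Sum>v\<in>V. a u v * (y u * y v))" for y
  define N where "N y = (\<Sum>v\<in>V. (y v)\<^sup>2)" for y :: "'a \<Rightarrow> real"
  obtain w where w: "w \<in> V" using ne by auto
  have "(\<lambda>v. if v = w then 1 else 0) \<in> S"
    using w fin by (auto simp: S_def if_distrib[of "\<lambda>x. x\<^sup>2"] cong: if_cong)
  then have "S \<noteq> {}" by auto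
  moreover have "compact S" unfolding S_def by (rule compact_unit_sphere_fun[OF fin])
  moreover have "continuous_on S Q"
    unfolding Q_def
    by (intro continuous_intros continuous_on_subset[OF continuous_on_product_coordinates]) auto
  ultimately obtain x where x: "x \<in> S" and max: "\<And>y. y \<in> S \<Longrightarrow> Q y \<le> Q x"
    using continuous_attains_sup[of S Q] by auto
  have N0: "y v = 0" if "N y = 0" "v \<in> V" for y v
    using that fin by (simp add: N_def sum_nonneg_eq_0_iff)
  have bound: "Q y \<le> Q x * N y" for y
  proof (cases "N y = 0")
    case True
    then have "Q y = 0" unfolding Q_def by (simp add: N0)
    then show ?thesis using True by simp
  next
    case False
    then have pos: "N y > 0"
      by (metis N_def less_eq_real_def sum_nonneg zero_le_power2)
    \<comment> \<open>Rescale \<open>y\<close> to norm 1 and cut it off outside \<open>V\<close>, so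
      that it lies in \<open>S\<close>; numerator and denominator both scale by
      \<open>s\<^sup>2\<close>.\<close>
    define s where "s = sqrt (N y)"
    have s: "s > 0" "s\<^sup>2 = N y" using pos by (auto simp: s_def)
    define z where "z v = (if v \<in> V then y v / s else 0)" for v
    have "N z = N y / s\<^sup>2"
      unfolding N_def z_def sum_divide_distrib by (simp add: power_divide)
    then have "z \<in> S" using s pos by (auto simp: S_def N_def z_def)
    then have "Q z \<le> Q x" by (rule max)
    moreover have "Q z = Q y / s\<^sup>2"
      unfolding Q_def z_def sum_divide_distrib by (simp add: power2_eq_square)
    ultimately show ?thesis using s pos by (simp add: field_simps)
  qed
  have "(\<Sum>v\<in>V. a u v * x v) = Q x * x u" if u: "u \<in> V" for u
  proof -
    define e where "e v = (if v = u then 1 else (0::real))" for v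
    have lin: "(\<Sum>v\<in>V. f v * e v) = f u" for f
      using u fin by (simp add: e_def if_distrib[of "\<lambda>x. _ * x"] cong: if_cong)
    have lin2: "(\<Sum>w\<in>V. \<Sum>v\<in>V. a w v * (x w * e v)) = (\<Sum>v\<in>V. a u v * x v)"
      "(\<Sum>w\<in>V. \<Sum>v\<in>V. a w v * (e w * x v)) = (\<Sum>v\<in>V. a u v * x v)"
    proof -
      have "(\<Sum>w\<in>V. \<Sum>v\<in>V. a w v * (x w * e v)) = (\<Sum>w\<in>V. a w u * x w)"
        using lin[of "\<lambda>v. a _ v * x _"] by (simp add: mult.assoc)
      also have "\<dots> = (\<Sum>v\<in>V. a u v * x v)"
        using sym u by (intro sum.cong) auto
      finally show "(\<Sum>w\<in>V. \<Sum>v\<in>V. a w v * (x w * e v)) = (\<Sum>v\<in>V. a u v * x v)" .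
      have "(\<Sum>w\<in>V. \<Sum>v\<in>V. a w v * (e w * x v)) = (\<Sum>w\<in>V. (\<Sum>v\<in>V. a w v * x v) * e w)"
        by (simp add: sum_distrib_right sum_distrib_left mult_ac)
      then show "(\<Sum>w\<in>V. \<Sum>v\<in>V. a w v * (e w * x v)) = (\<Sum>v\<in>V. a u v * x v)"
        using lin by simp
    qed
    \<comment> \<open>By \<open>bound\<close>, \<open>Q x * N - Q\<close> is nonnegative along the
      line \<open>x + t * e\<close>, and it is 0 at \<open>t = 0\<close> because
      \<open>N x = 1\<close>. Its linear coefficient is twice the defect of the eigenvalue equation
      at \<open>u\<close>.\<close>
    have "0 \<le> 2 * t * (Q x * x u - (\<Sum>v\<in>V. a u v * x v)) + t\<^sup>2 * (Q x * N e - Q e)" for t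
    proof -
      have "N (\<lambda>v. x v + t * e v) = (\<Sum>v\<in>V. (x v)\<^sup>2 + 2 * t * (x v * e v) + t\<^sup>2 * (e v)\<^sup>2)"
        unfolding N_def by (intro sum.cong) (auto simp: power2_eq_square algebra_simps)
      also have "\<dots> = N x + 2 * t * x u + t\<^sup>2 * N e"
        unfolding N_def sum.distrib sum_distrib_left[symmetric] lin ..
      finally have 1: "N (\<lambda>v. x v + t * e v) = N x + 2 * t * x u + t\<^sup>2 * N e" .
      have "Q (\<lambda>v. x v + t * e v) = (\<Sum>w\<in>V. \<Sum>v\<in>V. a w v * (x w * x v)
          + t * (a w v * (x w * e v)) + t * (a w v * (e w * x v)) + t\<^sup>2 * (a w v * (e w * e v)))"
        unfolding Q_def by (intro sum.cong) (auto simp: power2_eq_square algebra_simps)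
      also have "\<dots> = Q x + 2 * t * (\<Sum>v\<in>V. a u v * x v) + t\<^sup>2 * Q e"
        unfolding Q_def sum.distrib sum_distrib_left[symmetric] lin2 by simp
      finally have 2: "Q (\<lambda>v. x v + t * e v) = Q x + 2 * t * (\<Sum>v\<in>V. a u v * x v) + t\<^sup>2 * Q e" .
      have "N x = 1" using x by (simp add: S_def N_def)
      then show ?thesis
        using bound[of "\<lambda>v. x v + t * e v"] unfolding 1 2 by (simp add: algebra_simps)
    qed
    from linear_coeff_zero_if_quadratic_nonneg[OF this] show ?thesis by simp
  qed
  moreover have "\<exists>u\<in>V. x u \<noteq> 0"
  proof (rule ccontr)
    assume "\<not> ?thesis"
    then have "(\<Sum>v\<in>V. (x v)\<^sup>2) = 0" by simp
    then show False using x by (simp add: S_def)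
  qed
  ultimately show ?thesis using that bound unfolding Q_def N_def by blast
qed

section \<open>Adjacency eigenvalues and the clique bound\<close>

definition neighbours :: "'a pair_pre_digraph \<Rightarrow> 'a \<Rightarrow> 'a set" where
  "neighbours G u = {v \<in> pverts G. (u, v) \<in> parcs G}"

text \<open>Replaces matrices by functions on the vertices, so that no later argument depends on an
  enumeration.\<close>

lemma adj_spectrum_iff:
  assumes "finite (pverts G)"
  shows "k \<in> adj_spectrum G \<longleftrightarrow>
    (\<exists>x. (\<exists>u\<in>pverts G. x u \<noteq> 0) \<and> (\<forall>u\<in>pverts G. sum x (neighbours G u) = k * x u))"
proof -
  obtain vs where vs: "distinct vs" "set vs = pverts G"
    using finite_distinct_list[OF assms] by auto
  show ?thesis
    using eigenvalue_adjacency_matrix_iff[OF vs, of k] assms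
    by (simp add: adj_spectrum_eq[OF vs] spectrum_def neighbours_def sum.inter_filter)
qed

lemma finite_adj_spectrum: "finite (adj_spectrum G)"
  unfolding adj_spectrum_def
  by (rule card_finite_spectrum(1)) (auto simp: adjacency_matrix_def)

text \<open>Has two uses: the bound is tested on indicator vectors of cliques, and the membership
  shows that the spectrum is nonempty, so that its minimum is attained.\<close>

lemma rayleigh_adj_spectrum:
  assumes "pair_graph G" and "pverts G \<noteq> {}"
  obtains k where "k \<in> adj_spectrum G"
    "\<And>y. (\<Sum>u\<in>pverts G. \<Sum>v\<in>neighbours G u. y u * y v) \<le> k * (\<Sum>v\<in>pverts G. (y v)\<^sup>2)"
proof -
  interpret pair_graph G by fact
  let ?V = "pverts G"
  define a where "a u v = (if (u, v) \<in> parcs G then 1 else (0::real))" for u v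
  have a: "(\<Sum>v\<in>?V. a u v * f v) = sum f (neighbours G u)" for u f
    unfolding a_def neighbours_def using pair_finite_verts
    by (simp add: sum.inter_filter if_distrib[of "\<lambda>x. x * _"] cong: if_cong)
  have a_sym: "a u v = a v u" for u v
    using pair_sym_arcs by (auto simp: a_def symmetric_def dest: symD)
  obtain k x where "\<exists>u\<in>?V. x u \<noteq> 0" "\<forall>u\<in>?V. (\<Sum>v\<in>?V. a u v * x v) = k * x u"
    and bound: "\<And>y. (\<Sum>u\<in>?V. \<Sum>v\<in>?V. a u v * (y u * y v)) \<le> k * (\<Sum>v\<in>?V. (y v)\<^sup>2)"
    by (rule rayleigh_max_eigenvector[OF pair_finite_verts assms(2), of a, OF a_sym]) blast
  then have "k \<in> adj_spectrum G"
    using pair_finite_verts by (auto simp: adj_spectrum_iff a)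
  then show ?thesis using that bound unfolding a by blast
qed

lemma clique_le_largest_eigenvalue:
  assumes "pair_graph G" and "U \<subseteq> pverts G" and "U \<noteq> {}"
    and clique: "\<And>u v. u \<in> U \<Longrightarrow> v \<in> U \<Longrightarrow> u \<noteq> v \<Longrightarrow> (u, v) \<in> parcs G"
  shows "real (card U) - 1 \<le> largest_eigenvalue G"
proof -
  interpret pair_graph G by fact
  have fin: "finite U" using assms(2) pair_finite_verts by (rule finite_subset)
  have finN: "finite (neighbours G u)" for u
    using pair_finite_verts by (simp add: neighbours_def)
  define y where "y v = (if v \<in> U then 1 else (0::real))" for v
  obtain k where k: "k \<in> adj_spectrum G"
    and bound: "(\<Sum>u\<in>pverts G. \<Sum>v\<in>neighbours G u. y u * y v) \<le> k * (\<Sum>v\<in>pverts G. (y v)\<^sup>2)"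
    using rayleigh_adj_spectrum[OF assms(1)] assms(2,3) by blast
  \<comment> \<open>Both sides count ordered pairs of distinct vertices of the clique. Since
    \<open>y\<close> is nonnegative, enlarging the index sets to the full form can only increase the
    sum.\<close>
  have "real (card U) * (real (card U) - 1) = (\<Sum>u\<in>U. \<Sum>v\<in>U - {u}. y u * y v)"
  proof -
    have "(\<Sum>v\<in>U - {u}. y u * y v) = real (card U) - 1" if "u \<in> U" for u
    proof -
      have "(\<Sum>v\<in>U - {u}. y u * y v) = (\<Sum>v\<in>U - {u}. 1)"
        using that by (intro sum.cong) (auto simp: y_def)
      also have "\<dots> = real (card U) - 1"
        using that fin card_gt_0_iff[of U] by (auto simp: card_Diff_singleton of_nat_diff)
      finally show ?thesis .
    qed
    then show ?thesis by simp
  qed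
  also have "\<dots> \<le> (\<Sum>u\<in>U. \<Sum>v\<in>neighbours G u. y u * y v)"
    using clique assms(2) finN
    by (intro sum_mono sum_mono2) (auto simp: neighbours_def y_def)
  also have "\<dots> \<le> (\<Sum>u\<in>pverts G. \<Sum>v\<in>neighbours G u. y u * y v)"
    using assms(2) pair_finite_verts by (intro sum_mono2) (auto simp: y_def intro!: sum_nonneg)
  also note bound
  also have "(\<Sum>v\<in>pverts G. (y v)\<^sup>2) = (\<Sum>v\<in>pverts G. if v \<in> U then 1 else 0)"
    by (intro sum.cong) (auto simp: y_def)
  also have "\<dots> = real (card U)"
    using pair_finite_verts assms(2) by (simp add: sum.If_cases Int_absorb1)
  finally have "real (card U) - 1 \<le> k"
    using fin assms(3) by (simp add: mult.commute card_gt_0_iff)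
  also have "k \<le> largest_eigenvalue G"
    unfolding largest_eigenvalue_def using finite_adj_spectrum k by (rule Max_ge)
  finally show ?thesis .
qed

section \<open>Eigenvector entries of maximal modulus\<close>

lemma max_entry_degree:
  fixes x :: "'a \<Rightarrow> real" and k :: real
  assumes fin: "finite N" and eq: "sum x N = k * x u" and nz: "x u \<noteq> 0"
    and max: "\<And>v. v \<in> N \<Longrightarrow> \<bar>x v\<bar> \<le> \<bar>x u\<bar>"
  shows "\<bar>k\<bar> \<le> card N"
    and "card N \<le> \<bar>k\<bar> \<Longrightarrow> v \<in> N \<Longrightarrow> \<bar>x v\<bar> = \<bar>x u\<bar>"
proof -
  \<comment> \<open>Triangle inequality in the eigenvalue equation at \<open>u\<close>.\<close>
  have 1: "\<bar>k\<bar> * \<bar>x u\<bar> \<le> (\<Sum>v\<in>N. \<bar>x v\<bar>)"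
    using sum_abs[of x N] by (simp add: eq abs_mult)
  have "(\<Sum>v\<in>N. \<bar>x v\<bar>) \<le> card N * \<bar>x u\<bar>"
    using max by (intro sum_bounded_above) auto
  with 1 have "\<bar>k\<bar> * \<bar>x u\<bar> \<le> card N * \<bar>x u\<bar>" by (rule order_trans)
  then show "\<bar>k\<bar> \<le> card N" using nz by simp
  assume *: "card N \<le> \<bar>k\<bar>" "v \<in> N"
  \<comment> \<open>Equality case: nonnegative deficits with total at most 0 must all
    vanish.\<close>
  have "(\<Sum>v\<in>N. \<bar>x u\<bar> - \<bar>x v\<bar>) = card N * \<bar>x u\<bar> - (\<Sum>v\<in>N. \<bar>x v\<bar>)"
    by (simp add: sum_subtractf)
  also have "\<dots> \<le> 0"
    using 1 mult_right_mono[OF *(1), of "\<bar>x u\<bar>"] by simp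
  finally have "(\<Sum>v\<in>N. \<bar>x u\<bar> - \<bar>x v\<bar>) = 0"
    using max by (intro antisym sum_nonneg) auto
  then have "\<bar>x u\<bar> - \<bar>x v\<bar> = 0"
    using fin max *(2) by (subst (asm) sum_nonneg_eq_0_iff) auto
  then show "\<bar>x v\<bar> = \<bar>x u\<bar>" by simp
qed

lemma obtain_max_entry:
  fixes x :: "'a \<Rightarrow> real"
  assumes "finite V" and "\<exists>u\<in>V. x u \<noteq> 0"
  obtains u where "u \<in> V" "x u \<noteq> 0" "\<And>v. v \<in> V \<Longrightarrow> \<bar>x v\<bar> \<le> \<bar>x u\<bar>"
proof -
  have "Max ((\<lambda>v. \<bar>x v\<bar>) ` V) \<in> (\<lambda>v. \<bar>x v\<bar>) ` V"
    using assms by (intro Max_in) auto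
  then obtain u where u: "u \<in> V" "\<bar>x u\<bar> = Max ((\<lambda>v. \<bar>x v\<bar>) ` V)" by auto
  have "\<bar>x v\<bar> \<le> \<bar>x u\<bar>" if "v \<in> V" for v
    using that assms(1) u(2) by simp
  moreover from this assms(2) have "x u \<noteq> 0" by fastforce
  ultimately show ?thesis using that u(1) by blast
qed

lemma abs_adj_spectrum_le:
  assumes fin: "finite (pverts G)" and "k \<in> adj_spectrum G"
    and deg: "\<And>u. u \<in> pverts G \<Longrightarrow> card (neighbours G u) \<le> d"
  shows "\<bar>k\<bar> \<le> real d"
proof -
  obtain x where x: "\<exists>u\<in>pverts G. x u \<noteq> 0"
    and eq: "\<forall>u\<in>pverts G. sum x (neighbours G u) = k * x u"
    using assms(2) by (auto simp: adj_spectrum_iff[OF fin])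
  obtain u where u: "u \<in> pverts G" "x u \<noteq> 0" "\<And>v. v \<in> pverts G \<Longrightarrow> \<bar>x v\<bar> \<le> \<bar>x u\<bar>"
    using obtain_max_entry[OF fin x] by blast
  have "\<bar>k\<bar> \<le> card (neighbours G u)"
    using max_entry_degree(1)[of "neighbours G u" x k u] fin eq u by (auto simp: neighbours_def)
  also have "\<dots> \<le> real d" using deg u(1) by simp
  finally show ?thesis .
qed

text \<open>The maximal entry is taken to lie in \<open>U\<close>; the final theorem exchanges the
  parts when it lies in \<open>W\<close>.\<close>

lemma complete_bipartite_if_large_eigenvalue:
  fixes x :: "'a \<Rightarrow> real" and k :: real
  assumes fin: "finite U" "finite W" and V: "pverts G = U \<union> W" and disj: "U \<inter> W = {}"
    and arcs: "parcs G \<subseteq> U \<times> W \<union> W \<times> U" and sym: "\<And>u v. (u, v) \<in> parcs G \<Longrightarrow> (v, u) \<in> parcs G"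
    and x: "\<And>u. u \<in> pverts G \<Longrightarrow> sum x (neighbours G u) = k * x u"
    and u: "u \<in> U" "x u \<noteq> 0" "\<And>v. v \<in> pverts G \<Longrightarrow> \<bar>x v\<bar> \<le> \<bar>x u\<bar>"
    and k: "card U \<le> \<bar>k\<bar>" "card W \<le> \<bar>k\<bar>"
  shows "card U = card W" and "parcs G = U \<times> W \<union> W \<times> U"
proof -
  have finN: "finite (neighbours G v)" for v
    using fin V by (simp add: neighbours_def)
  have NU: "neighbours G v \<subseteq> W" if "v \<in> U" for v
    using that arcs disj by (auto simp: neighbours_def)
  have NW: "neighbours G v \<subseteq> U" if "v \<in> W" for v
    using that arcs disj by (auto simp: neighbours_def)
  \<comment> \<open>The chain \<open>card (neighbours G v)\<close> \<le> \<open>card B\<close> \<le>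
    \<open>\<bar>k\<bar>\<close> \<le> \<open>card (neighbours G v)\<close> collapses, so
    \<open>v\<close> is joined to all of \<open>B\<close>. The equality case passes the maximal
    modulus on to \<open>B\<close>, where \<open>full\<close> can be applied again.\<close>
  have full: "neighbours G v = B \<and> card B = \<bar>k\<bar> \<and> (\<forall>w\<in>B. \<bar>x w\<bar> = \<bar>x v\<bar>)"
    if v: "v \<in> pverts G" "\<bar>x v\<bar> = \<bar>x u\<bar>" and B: "neighbours G v \<subseteq> B" "card B \<le> \<bar>k\<bar>" "finite B"
    for v B
  proof -
    have nz: "x v \<noteq> 0" and mx: "\<And>w. w \<in> neighbours G v \<Longrightarrow> \<bar>x w\<bar> \<le> \<bar>x v\<bar>"
      using v u by (auto simp: neighbours_def)
    note deg = max_entry_degree[OF finN x[OF v(1)] nz mx]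
    have "card (neighbours G v) \<le> card B" using B by (intro card_mono)
    then have "card (neighbours G v) = card B" "card B = \<bar>k\<bar>"
      using deg(1) B(2) by linarith+
    then show ?thesis
      using deg(2) card_subset_eq[OF B(3) B(1)] by auto
  qed
  have fu: "neighbours G u = W" "card W = \<bar>k\<bar>" "\<forall>w\<in>W. \<bar>x w\<bar> = \<bar>x u\<bar>"
    using full[of u W] NU[of u] u V k fin by auto
  have fw: "neighbours G w = U" "card U = \<bar>k\<bar>" if "w \<in> W" for w
    using full[of w U] NW[of w] that V k fin fu(3) by auto
  \<comment> \<open>\<open>fw\<close> determines \<open>card U\<close> only through a vertex of
    \<open>W\<close>. An empty \<open>W\<close> would give \<open>k = 0\<close> and hence an empty
    \<open>U\<close>, which contains \<open>u\<close>.\<close>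
  have "W \<noteq> {}"
  proof
    assume "W = {}"
    then have "k = 0" using fu(2) by simp
    then show False using k(1) u(1) fin(1) by auto
  qed
  then show "card U = card W" using fw(2) fu(2) by fastforce
  show "parcs G = U \<times> W \<union> W \<times> U"
  proof
    have "(w, v) \<in> parcs G" if "w \<in> W" "v \<in> U" for w v
      using fw(1)[OF that(1)] that(2) by (auto simp: neighbours_def)
    then show "U \<times> W \<union> W \<times> U \<subseteq> parcs G" using sym by auto
  qed (rule arcs)
qed

section \<open>Extremal eigenvalues of K_{r,r} and its complement\<close>

lemma balanced_complete_bipartite_eigenvalues:
  assumes fin: "finite (pverts G)" and V: "pverts G = U \<union> W" and disj: "U \<inter> W = {}"
    and card: "card U = r" "card W = r" and r: "r \<ge> 1" and arcs: "parcs G = U \<times> W \<union> W \<times> U"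
  shows "least_eigenvalue G = - real r" and "largest_eigenvalue (complement G) = real r - 1"
proof -
  have f: "finite U" "finite W" using fin V by auto
  have ne: "U \<noteq> {}" using card r by auto
  let ?H = "complement G"
  have finH: "finite (pverts ?H)" using fin by (simp add: complement_def)
  have N: "neighbours G u = (if u \<in> U then W else U)" if "u \<in> pverts G" for u
    using that V disj arcs by (auto simp: neighbours_def)
  have NH: "neighbours ?H u = (if u \<in> U then U else W) - {u}" if "u \<in> pverts G" for u
    using that V disj arcs by (auto simp: neighbours_def complement_def)
  have cH: "card (neighbours ?H u) = r - 1" if "u \<in> pverts G" for u
    using that V f card by (auto simp: NH card_Diff_singleton)
  \<comment> \<open>Changing sign between the parts turns each neighbour sum into \<open>- r\<close>
    times the entry. The degree bound \<open>r\<close> then shows that no eigenvalue is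
    smaller.\<close>
  define x where "x v = (if v \<in> U then 1 else - 1 :: real)" for v
  have "sum x U = (\<Sum>v\<in>U. 1)" "sum x W = (\<Sum>v\<in>W. - 1)"
    using disj by (intro sum.cong; auto simp: x_def)+
  then have sx: "sum x U = r" "sum x W = - real r" using card by auto
  have "- real r \<in> adj_spectrum G"
    unfolding adj_spectrum_iff[OF fin]
  proof (intro exI[of _ x] conjI ballI)
    show "\<exists>u\<in>pverts G. x u \<noteq> 0" using ne V by (auto simp: x_def)
    show "sum x (neighbours G u) = - real r * x u" if "u \<in> pverts G" for u
      using that sx by (simp add: N) (simp add: x_def)
  qed
  moreover have "- real r \<le> k" if "k \<in> adj_spectrum G" for k
    using abs_adj_spectrum_le[OF fin that, of r] card by (force simp: N abs_le_iff)
  ultimately show "least_eigenvalue G = - real r"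
    unfolding least_eigenvalue_def by (intro Min_eqI finite_adj_spectrum)
  \<comment> \<open>The complement consists of two disjoint cliques of size \<open>r\<close>, so it
    is regular of degree \<open>r - 1\<close> with the constant eigenvector. The subtraction is on
    naturals and agrees with the real one as \<open>r\<close> is positive.\<close>
  have "real (r - 1) \<in> adj_spectrum ?H"
    unfolding adj_spectrum_iff[OF finH]
    using ne V cH by (intro exI[of _ "\<lambda>_. 1"]) (auto simp: complement_def)
  moreover have "k \<le> real (r - 1)" if "k \<in> adj_spectrum ?H" for k
    using abs_adj_spectrum_le[OF finH that, of "r - 1"] cH by (auto simp: complement_def abs_le_iff)
  ultimately have "largest_eigenvalue ?H = real (r - 1)"
    unfolding largest_eigenvalue_def by (intro Max_eqI finite_adj_spectrum)
  then show "largest_eigenvalue ?H = real r - 1" using r by (simp add: of_nat_diff)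
qed

section \<open>Comparing the two eigenvalues\<close>

lemma parts_le_largest_eigenvalue_complement:
  assumes "pair_graph G" and V: "pverts G = U \<union> W" and disj: "U \<inter> W = {}"
    and arcs: "parcs G \<subseteq> U \<times> W \<union> W \<times> U" and ne: "pverts G \<noteq> {}"
  shows "real (card U) - 1 \<le> largest_eigenvalue (complement G)"
proof -
  have le: "real (card A) - 1 \<le> largest_eigenvalue (complement G)"
    if "A = U \<or> A = W" "A \<noteq> {}" for A
    using that V disj arcs
    by (intro clique_le_largest_eigenvalue pair_graph_complement assms(1)) (auto simp: complement_def)
  show ?thesis
  proof (cases "U = {}")
    \<comment> \<open>The clique bound asks for a nonempty clique. For empty \<open>U\<close> the
      claim is a lower bound of -1, which the other part provides.\<close>
    case True
    then have "W \<noteq> {}" using ne V by auto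
    then have "real (card W) - 1 \<le> largest_eigenvalue (complement G)" using le by auto
    then show ?thesis using True by simp
  qed (use le in auto)
qed

theorem theorem3p7:
  fixes G :: "'a pair_pre_digraph" and n :: nat
  assumes "pair_graph G"
    and "card (pverts G) = n" and "n \<ge> 1"
    and "bipartite G"
  shows "largest_eigenvalue (complement G) = - 1 - least_eigenvalue G \<longleftrightarrow>
    (\<exists>r::nat. r \<ge> 1 \<and> complete_bipartite_digraph r r (with_proj G))"
proof
  interpret pair_graph G by fact
  have ne: "pverts G \<noteq> {}" using assms(2,3) by auto
  assume eq: "largest_eigenvalue (complement G) = - 1 - least_eigenvalue G"
  obtain U W where UW: "pverts G = U \<union> W" "U \<inter> W = {}" "parcs G \<subseteq> U \<times> W \<union> W \<times> U"
    using assms(4) by (auto simp: bipartite_def)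
  have WU: "pverts G = W \<union> U" "W \<inter> U = {}" "parcs G \<subseteq> W \<times> U \<union> U \<times> W"
    using UW by auto
  have fin: "finite U" "finite W" using pair_finite_verts UW by auto
  let ?k = "least_eigenvalue G"
  obtain k' where "k' \<in> adj_spectrum G"
    using rayleigh_adj_spectrum[OF assms(1) ne] by blast
  then have "?k \<in> adj_spectrum G"
    unfolding least_eigenvalue_def using finite_adj_spectrum by (intro Min_in) auto
  then obtain x where x: "\<exists>u\<in>pverts G. x u \<noteq> 0"
    "\<And>u. u \<in> pverts G \<Longrightarrow> sum x (neighbours G u) = ?k * x u"
    by (auto simp: adj_spectrum_iff[OF pair_finite_verts])
  obtain u where u: "u \<in> pverts G" "x u \<noteq> 0" "\<And>v. v \<in> pverts G \<Longrightarrow> \<bar>x v\<bar> \<le> \<bar>x u\<bar>"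
    using obtain_max_entry[OF pair_finite_verts x(1)] by blast
  \<comment> \<open>The identity turns the clique bound \<open>card U - 1\<close> \<le>
    \<open>- 1 - ?k\<close> into \<open>card U\<close> \<le> \<open>- ?k\<close>, and likewise for
    \<open>W\<close>.\<close>
  have k: "card U \<le> \<bar>?k\<bar>" "card W \<le> \<bar>?k\<bar>"
    using parts_le_largest_eigenvalue_complement[OF assms(1) UW ne]
      parts_le_largest_eigenvalue_complement[OF assms(1) WU ne] eq by linarith+
  have sym: "(v, w) \<in> parcs G" if "(w, v) \<in> parcs G" for v w
    using that pair_sym_arcs by (auto simp: symmetric_def dest: symD)
  have "card U = card W \<and> parcs G = U \<times> W \<union> W \<times> U"
  proof (cases "u \<in> U")
    case True
    then show ?thesis
      using complete_bipartite_if_large_eigenvalue[OF fin UW sym x(2) True u(2,3) k] by blast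
  next
    case False
    then have "u \<in> W" using u(1) UW(1) by auto
    from complete_bipartite_if_large_eigenvalue[OF fin(2,1) WU sym x(2) this u(2,3) k(2,1)]
    show ?thesis by auto
  qed
  moreover from this have "card U \<ge> 1"
    using ne UW(1) fin by (metis One_nat_def Suc_leI Un_empty card_gt_0_iff)
  ultimately show "\<exists>r\<ge>1. complete_bipartite_digraph r r (with_proj G)"
    using UW pair_finite_verts unfolding complete_bipartite_digraph_pair_def by metis
next
  assume "\<exists>r\<ge>1. complete_bipartite_digraph r r (with_proj G)"
  then obtain r U W where "r \<ge> 1" "finite (pverts G)" "pverts G = U \<union> W" "U \<inter> W = {}"
    "card U = r" "card W = r" "parcs G = U \<times> W \<union> W \<times> U"
    unfolding complete_bipartite_digraph_pair_def by blast
  with balanced_complete_bipartite_eigenvalues[of G U W r]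
  show "largest_eigenvalue (complement G) = - 1 - least_eigenvalue G" by simp
qed

end
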